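(* Let $\mathbf k$ be a field of characteristic $2$ which is finite or algebraically closed, $V$ a $\mathbf k$-vector space of even dimension $D$ with a nondegenerate quadratic form $Q$, and assume there exists a $D/2$-dimensional subspace $S\subset V$ with $Q|_S=0$. Let $N\in\tilde{\mathcal M}_Q$. Then for any such $S$, $\dim\big(S/(S\cap(1+N)(S))\big)\equiv\dim\ker N\pmod 2$.
   Context: $\langle x,y\rangle=Q(x+y)-Q(x)-Q(y)$ (here alternating, since the characteristic is $2$), with radical $R$; $Q$ is nondegenerate if $Q|_R$ is injective (for $D$ even this forces $R=0$). $\tilde{\mathcal M}_Q$ is the set of nilpotent $N\in\mathrm{End}(V)$ with $Q(Nx)=-\langle x,Nx\rangle$ for all $x\in V$ (equivalently, $1+N$ is a unipotent element of the orthogonal group $O_Q$). *)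

theory Defs
  imports "HOL-Analysis.Analysis" "HOL-Computational_Algebra.Polynomial"
begin

text \<open>Algebraically closed field: every nonconstant polynomial has a root.\<close>
definition alg_closed_type :: "'k::field itself \<Rightarrow> bool" where
  "alg_closed_type _ \<longleftrightarrow> (\<forall>p::'k poly. degree p > 0 \<longrightarrow> (\<exists>x. poly p x = 0))"

text \<open>Polar form of Q.\<close>
definition polar :: "('k::field ^ 'n \<Rightarrow> 'k) \<Rightarrow> 'k ^ 'n \<Rightarrow> 'k ^ 'n \<Rightarrow> 'k" where
  "polar Q x y = Q (x + y) - Q x - Q y"

definition quadratic_form :: "('k::field ^ 'n \<Rightarrow> 'k) \<Rightarrow> bool" where
  "quadratic_form Q \<longleftrightarrow>
     (\<forall>c x. Q (c *s x) = c ^ 2 * Q x) \<and>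
     (\<forall>x y z. polar Q (x + y) z = polar Q x z + polar Q y z) \<and>
     (\<forall>c x y. polar Q (c *s x) y = c * polar Q x y)"

definition qf_radical :: "('k::field ^ 'n \<Rightarrow> 'k) \<Rightarrow> ('k ^ 'n) set" where
  "qf_radical Q = {x. \<forall>y. polar Q x y = 0}"

definition qf_nondegenerate :: "('k::field ^ 'n \<Rightarrow> 'k) \<Rightarrow> bool" where
  "qf_nondegenerate Q \<longleftrightarrow> inj_on Q (qf_radical Q)"

text \<open>Totally singular subspace of dimension D/2.\<close>
definition lagrangian :: "('k::field ^ 'n \<Rightarrow> 'k) \<Rightarrow> ('k ^ 'n) set \<Rightarrow> bool" where
  "lagrangian Q S \<longleftrightarrow> vec.subspace S \<and> vec.dim S = CARD('n) div 2 \<and> (\<forall>x\<in>S. Q x = 0)"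

text \<open>The set \<open>\<tilde>M_Q\<close>: nilpotent endomorphisms N with Q(Nx) = - <x, Nx>.\<close>
definition M_tilde :: "('k::field ^ 'n \<Rightarrow> 'k) \<Rightarrow> ('k ^ 'n \<Rightarrow> 'k ^ 'n) set" where
  "M_tilde Q = {N. Vector_Spaces.linear (*s) (*s) N \<and> (\<exists>m. \<forall>x. (N ^^ m) x = 0) \<and>
                   (\<forall>x. Q (N x) = - polar Q x (N x))}"

end

theory Submission
  imports Defs
begin

(*
  The polar form B of Q is alternating in characteristic 2, so its radical has even
  codimension. Q is additive on the radical and every scalar is a square, so for a nonzero
  radical vector x and any radical vector f some f + c x has Q = 0; as Q is injective on the
  radical, the radical is at most a line, hence 0. Thus B is nondegenerate and every
  Lagrangian L satisfies orth L = L.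

  Let T = (1 + N) S, U = N S and Y = {x. N x \<in> T}. As 1 + N is an isometry, T is
  Lagrangian, and B x (N y) = - B (N x) ((1 + N) y) gives Y = orth U. On Y the form
  (x, y) \<mapsto> B x (N y) is alternating, because B y (N y) = - Q (N y) and Q vanishes on T;
  its radical is R = {y \<in> Y. N y \<in> U}, so dim Y and dim R have the same parity. Finally N
  maps R and S \<inter> T onto U \<inter> T with kernels ker N and ker N \<inter> S, whence modulo 2
    dim S - dim (S \<inter> T) = dim U - dim (U \<inter> T) = D - dim Y - dim (U \<inter> T)
                        = dim R - dim (U \<inter> T) = dim (ker N).
*)

lemma linear_vecI:
  fixes f :: "'k::field^'n \<Rightarrow> 'k^'m"
  assumes "\<And>x y. f (x + y) = f x + f y" and "\<And>c x. f (c *s x) = c *s f x"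
  shows "Vector_Spaces.linear (*s) (*s) f"
  unfolding Vector_Spaces.linear_iff by (simp add: assms vec.vector_space_axioms)

lemma dim_vec_le_CARD: "vec.dim (U :: ('k::field^'n) set) \<le> CARD('n)"
  using vec.dim_subset[of U UNIV] by (simp add: card_cart_basis)

lemma span_inter_span_subset_0:
  fixes X Y :: "('k::field^'n) set"
  assumes indep: "vec.independent (X \<union> Y)" and disjoint: "X \<inter> Y = {}"
  shows "vec.span X \<inter> vec.span Y \<subseteq> {0}"
proof -
  have "vec.independent X" "vec.independent Y" using indep vec.independent_mono by blast+
  moreover have "finite X" "finite Y" using indep vec.finiteI_independent by blast+
  moreover have "vec.dim (vec.span (X \<union> Y)) + vec.dim (vec.span X \<inter> vec.span Y)
      = vec.dim (vec.span X) + vec.dim (vec.span Y)"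
    using vec.dim_sums_Int[OF vec.subspace_span vec.subspace_span, of X Y]
    by (simp only: vec.span_Un)
  ultimately show ?thesis
    using indep disjoint by (simp add: vec.dim_eq_card_independent card_Un_disjoint)
qed

lemma rank_nullity_subspace:
  fixes f :: "'k::field^'n \<Rightarrow> 'k^'m"
  assumes lin: "Vector_Spaces.linear (*s) (*s) f" and A: "vec.subspace A"
  shows "vec.dim A = vec.dim (f ` A) + vec.dim {x\<in>A. f x = 0}"
proof -
  interpret f: Vector_Spaces.linear "(*s)" "(*s)" f by (rule lin)
  define K where "K = {x\<in>A. f x = 0}"
  have K: "vec.subspace K" using A by (auto simp: K_def vec.subspace_def f.add f.scale)
  obtain BK where BK: "BK \<subseteq> K" "vec.independent BK" "K \<subseteq> vec.span BK" "card BK = vec.dim K"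
    using vec.basis_exists[of K] by blast
  moreover have "K \<subseteq> A" by (auto simp: K_def)
  ultimately have "BK \<subseteq> A" by blast
  then obtain C where C: "BK \<subseteq> C" "C \<subseteq> A" "vec.independent C" "A \<subseteq> vec.span C"
    by (rule vec.maximal_independent_subset_extend[OF _ BK(2)])
  define E where "E = C - BK"
  have CU: "C = BK \<union> E" and "BK \<inter> E = {}" using C(1) unfolding E_def by blast+
  have indE: "vec.independent E" using C(3) vec.independent_mono unfolding E_def by blast
  have disjoint: "vec.span BK \<inter> vec.span E \<subseteq> {0}"
    using span_inter_span_subset_0[of BK E, folded CU] C(3) \<open>BK \<inter> E = {}\<close> by blast
  have sums: "A = {k + e |k e. k \<in> vec.span BK \<and> e \<in> vec.span E}"
    using vec.span_subspace[OF C(2,4) A] by (simp only: CU vec.span_Un)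
  have spanBK: "vec.span BK \<subseteq> K" using BK(1) K vec.span_minimal by blast
  have spanE: "vec.span E \<subseteq> A" using C(2) A vec.span_minimal[of E A] by (auto simp: E_def)
  have f_drop_kernel_part: "f (k + e) = f e" if "k \<in> vec.span BK" for k e
    using that spanBK by (auto simp: K_def f.add)
  have "f ` A \<subseteq> f ` vec.span E" unfolding sums using f_drop_kernel_part by auto
  then have image: "f ` A = f ` vec.span E" using spanE by blast
  have "inj_on f (vec.span E)"
    unfolding f.inj_on_iff_eq_0[OF vec.subspace_span]
    using spanE BK(3) disjoint by (auto simp: K_def)
  then have "vec.dim (f ` A) = card E"
    unfolding image using vec.dim_image_eq[OF lin] vec.dim_span_eq_card_independent[OF indE]
    by (simp add: vec.span_span)
  moreover have "vec.dim A = card C"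
    using vec.dim_span_eq_card_independent[OF C(3)] vec.span_subspace[OF C(2,4) A] by simp
  moreover have "card C = card BK + card E"
    using card_Un_disjoint[of BK E] vec.finiteI_independent[OF BK(2)]
      vec.finiteI_independent[OF indE] \<open>BK \<inter> E = {}\<close> CU by simp
  ultimately show ?thesis using BK(4) K_def by simp
qed

lemma dim_kernel_functional:
  fixes \<phi> :: "'k::field^'n \<Rightarrow> 'k"
  assumes add: "\<And>x y. \<phi> (x + y) = \<phi> x + \<phi> y" and scale: "\<And>c x. \<phi> (c *s x) = c * \<phi> x"
    and A: "vec.subspace A" and z: "z \<in> A" "\<phi> z \<noteq> 0"
  shows "vec.dim {w\<in>A. \<phi> w = 0} + 1 = vec.dim A"
proof -
  define e :: "'k^'n" where "e = axis undefined 1"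
  have e: "e \<noteq> 0" by (simp add: e_def axis_eq_0_iff)
  define f where "f x = \<phi> x *s e" for x
  have lin: "Vector_Spaces.linear (*s) (*s) f"
    by (rule linear_vecI) (simp_all add: f_def add scale vec.scale_left_distrib)
  have "f ` A = vec.span {e}"
  proof
    show "f ` A \<subseteq> vec.span {e}" by (auto simp: f_def vec.span_singleton)
    have "c *s e = f ((c / \<phi> z) *s z)" for c using z(2) by (simp add: f_def scale)
    then show "vec.span {e} \<subseteq> f ` A"
      using A z(1) vec.subspace_scale by (fastforce simp: vec.span_singleton)
  qed
  then have "vec.dim (f ` A) = 1" using e by simp
  moreover have "{x\<in>A. f x = 0} = {w\<in>A. \<phi> w = 0}" using e by (auto simp: f_def)
  ultimately show ?thesis using rank_nullity_subspace[OF lin A] by simp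
qed

locale bilinear_form =
  fixes B :: "'k::field^'n \<Rightarrow> 'k^'n \<Rightarrow> 'k"
  assumes add_left: "B (x + y) z = B x z + B y z"
    and scale_left: "B (c *s x) z = c * B x z"
    and add_right: "B x (y + z) = B x y + B x z"
    and scale_right: "B x (c *s z) = c * B x z"
begin

lemma diff_left: "B (x - y) z = B x z - B y z"
  using add_left[of "x - y" y z] by simp

lemma diff_right: "B x (y - z) = B x y - B x z"
  using add_right[of x "y - z" z] by simp

lemma zero_left [simp]: "B 0 z = 0"
  using scale_left[of 0 0 z] by simp

lemma zero_right [simp]: "B x 0 = 0"
  using scale_right[of x 0 0] by simp

lemmas bilinear_simps = add_left scale_left add_right scale_right diff_left diff_right

definition orth :: "('k^'n) set \<Rightarrow> ('k^'n) set" where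
  "orth U = {x. \<forall>u\<in>U. B x u = 0}"

definition radical :: "('k^'n) set \<Rightarrow> ('k^'n) set" where
  "radical Y = {y\<in>Y. \<forall>x\<in>Y. B x y = 0}"

lemma subspace_orth: "vec.subspace (orth U)"
  unfolding vec.subspace_def orth_def by (simp add: bilinear_simps)

lemma orth_antimono: "X \<subseteq> Y \<Longrightarrow> orth Y \<subseteq> orth X"
  by (auto simp: orth_def)

lemma orth_Un: "orth (X \<union> Y) = orth X \<inter> orth Y"
  by (auto simp: orth_def)

lemma orth_span: "orth (vec.span X) = orth X"
proof
  show "orth (vec.span X) \<subseteq> orth X" using vec.span_superset by (auto simp: orth_def)
  show "orth X \<subseteq> orth (vec.span X)"
  proof
    fix x assume x: "x \<in> orth X"
    have "vec.subspace {v. B x v = 0}" by (simp add: vec.subspace_def bilinear_simps)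
    moreover have "X \<subseteq> {v. B x v = 0}" using x by (auto simp: orth_def)
    ultimately have "vec.span X \<subseteq> {v. B x v = 0}" by (rule vec.span_minimal[rotated])
    then show "x \<in> orth (vec.span X)" by (auto simp: orth_def)
  qed
qed

lemma dim_orth_ge: "CARD('n) \<le> vec.dim (orth U) + vec.dim U"
proof -
  obtain Bs where Bs: "Bs \<subseteq> U" "vec.independent Bs" "U \<subseteq> vec.span Bs" "card Bs = vec.dim U"
    using vec.basis_exists[of U] by blast
  have fin: "finite Bs" using Bs(2) vec.finiteI_independent by blast
  obtain \<iota> :: "'k^'n \<Rightarrow> 'n" where \<iota>: "inj_on \<iota> Bs"
    using card_le_inj[OF fin, of "UNIV :: 'n set"] Bs(4) dim_vec_le_CARD[of U] by auto
  define f where "f x = (\<Sum>u\<in>Bs. B x u *s (axis (\<iota> u) 1 :: 'k^'n))" for x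
  have lin: "Vector_Spaces.linear (*s) (*s) f"
    by (rule linear_vecI)
      (simp_all add: f_def bilinear_simps vec.scale_left_distrib sum.distrib
        vec.scale_sum_right vec.scale_scale)
  have coord: "f x $ \<iota> u = B x u" if "u \<in> Bs" for x u
  proof -
    have "f x $ \<iota> u = (\<Sum>v\<in>Bs. if v = u then B x v else 0)"
      unfolding f_def sum_component
      by (rule sum.cong) (use \<iota> that in \<open>auto simp: axis_def inj_on_eq_iff\<close>)
    then show ?thesis using fin that by simp
  qed
  then have "{x\<in>UNIV. f x = 0} \<subseteq> orth (vec.span Bs)"
    unfolding orth_span by (auto simp: orth_def simp flip: coord)
  also have "\<dots> \<subseteq> orth U" using Bs(3) by (auto simp: orth_def)
  finally have kernel: "vec.dim {x\<in>UNIV. f x = 0} \<le> vec.dim (orth U)" by (rule vec.dim_subset)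
  define E where "E = (\<lambda>u. axis (\<iota> u) 1 :: 'k^'n) ` Bs"
  have "range f \<subseteq> vec.span E"
    unfolding f_def E_def by (clarify, intro vec.span_sum vec.span_scale vec.span_base) simp
  then have "vec.dim (range f) \<le> card E" using fin by (simp add: E_def vec.dim_le_card)
  also have "\<dots> \<le> vec.dim U" unfolding E_def using fin card_image_le Bs(4) by metis
  finally show ?thesis
    using kernel rank_nullity_subspace[OF lin vec.subspace_UNIV] by (simp add: card_cart_basis)
qed

lemma skew_if_alternating:
  assumes Y: "vec.subspace Y" and alt: "\<forall>y\<in>Y. B y y = 0" and "u \<in> Y" "v \<in> Y"
  shows "B u v = - B v u"
proof -
  have "0 = B (u + v) (u + v)" using alt assms(3,4) Y vec.subspace_add by metis
  also have "\<dots> = B u v + B v u" using alt assms(3,4) by (simp add: bilinear_simps)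
  finally show ?thesis by (simp add: eq_neg_iff_add_eq_0)
qed

lemma hyperbolic_pair_complement:
  assumes Y: "vec.subspace Y" and alt: "\<forall>y\<in>Y. B y y = 0"
    and e: "e \<in> Y" and f: "f \<in> Y" and ef: "B e f = 1"
  defines "Y' \<equiv> {w\<in>Y. B e w = 0 \<and> B f w = 0}"
  shows "vec.subspace Y'" and "vec.dim Y' + 2 = vec.dim Y" and "radical Y' = radical Y"
proof -
  have fe: "B f e = -1" using skew_if_alternating[OF Y alt f e] ef by simp
  define Y1 where "Y1 = {w\<in>Y. B e w = 0}"
  have Y1: "vec.subspace Y1" using Y by (simp add: Y1_def vec.subspace_def bilinear_simps)
  have Y': "Y' = {w\<in>Y1. B f w = 0}" by (auto simp: Y'_def Y1_def)
  show "vec.subspace Y'" using Y1 by (simp add: Y' vec.subspace_def bilinear_simps)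
  have "vec.dim Y1 + 1 = vec.dim Y"
    unfolding Y1_def by (rule dim_kernel_functional[OF _ _ Y f]) (simp_all add: bilinear_simps ef)
  moreover have "vec.dim Y' + 1 = vec.dim Y1"
    unfolding Y' using alt e
    by (intro dim_kernel_functional[OF _ _ Y1, where z = e])
      (simp_all add: bilinear_simps fe Y1_def)
  ultimately show "vec.dim Y' + 2 = vec.dim Y" by simp
  show "radical Y' = radical Y"
  proof
    show "radical Y \<subseteq> radical Y'" using e f by (auto simp: radical_def Y'_def)
    show "radical Y' \<subseteq> radical Y"
    proof
      fix y assume "y \<in> radical Y'"
      then have y: "y \<in> Y" "B e y = 0" "B f y = 0" "\<forall>x\<in>Y'. B x y = 0"
        by (auto simp: radical_def Y'_def)
      have "B x y = 0" if x: "x \<in> Y" for x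
      proof -
        \<comment> \<open>the projection of \<open>x\<close> to \<open>Y'\<close> along \<open>span {e, f}\<close>\<close>
        define x' where "x' = x + B f x *s e - B e x *s f"
        have "x' \<in> Y" unfolding x'_def
          using Y x e f vec.subspace_add vec.subspace_diff vec.subspace_scale by metis
        moreover have "B e x' = 0" "B f x' = 0"
          using alt e f by (simp_all add: x'_def bilinear_simps ef fe)
        ultimately have "B x' y = 0" using y(4) by (simp add: Y'_def)
        then show "B x y = 0" using y(2,3) by (simp add: x'_def bilinear_simps)
      qed
      then show "y \<in> radical Y" using y(1) by (simp add: radical_def)
    qed
  qed
qed

lemma even_dim_diff_radical:
  assumes "vec.subspace Y" and "\<forall>y\<in>Y. B y y = 0"
  shows "even (vec.dim Y - vec.dim (radical Y))"
  using assms
proof (induction "vec.dim Y" arbitrary: Y rule: less_induct)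
  case less
  show ?case
  proof (cases "radical Y = Y")
    case False
    then obtain e f where ef: "e \<in> Y" "f \<in> Y" "B e f \<noteq> 0" by (auto simp: radical_def)
    define e' where "e' = (1 / B e f) *s e"
    have e': "e' \<in> Y" "B e' f = 1"
      using ef less.prems(1) vec.subspace_scale by (auto simp: e'_def bilinear_simps)
    note Y' = hyperbolic_pair_complement[OF less.prems e'(1) ef(2) e'(2)]
    let ?Y' = "{w\<in>Y. B e' w = 0 \<and> B f w = 0}"
    have IH: "even (vec.dim ?Y' - vec.dim (radical Y))"
      using less.hyps[of ?Y'] Y' less.prems(2) by auto
    have "vec.dim (radical Y) \<le> vec.dim ?Y'"
      using Y'(3) by (metis (no_types, lifting) radical_def mem_Collect_eq subsetI vec.dim_subset)
    then have "vec.dim Y - vec.dim (radical Y) = vec.dim ?Y' - vec.dim (radical Y) + 2"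
      using Y'(2) by linarith
    with IH show ?thesis by simp
  qed simp
qed

end

locale nondegenerate_bilinear_form = bilinear_form B for B :: "'k::field^'n \<Rightarrow> 'k^'n \<Rightarrow> 'k" +
  assumes nondegenerate: "(\<forall>y. B x y = 0) \<Longrightarrow> x = 0"
begin

lemma dim_orth: "vec.dim (orth U) + vec.dim U = CARD('n)"
proof -
  obtain Bs where Bs: "Bs \<subseteq> U" "vec.independent Bs" "U \<subseteq> vec.span Bs" "card Bs = vec.dim U"
    using vec.basis_exists[of U] by blast
  obtain Bs' where Bs': "Bs \<subseteq> Bs'" "vec.independent Bs'" "UNIV \<subseteq> vec.span Bs'"
    by (rule vec.maximal_independent_subset_extend[OF subset_UNIV Bs(2)]) blast
  have fin: "finite Bs'" using Bs'(2) vec.finiteI_independent by blast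
  have span_Bs': "vec.span Bs' = UNIV" using Bs'(3) by auto
  have "card Bs' = CARD('n)"
    using vec.dim_span_eq_card_independent[OF Bs'(2)] by (simp add: span_Bs' card_cart_basis)
  \<comment> \<open>By nondegeneracy, \<open>orth U\<close> meets \<open>orth C\<close> trivially for the complement \<open>C\<close> of \<open>U\<close>.\<close>
  define C where "C = vec.span (Bs' - Bs)"
  have "vec.dim C = card (Bs' - Bs)"
    unfolding C_def using vec.independent_mono[OF Bs'(2), of "Bs' - Bs"]
    by (simp add: vec.dim_eq_card_independent)
  also have "\<dots> = CARD('n) - vec.dim U"
    using Bs(4) Bs'(1) \<open>card Bs' = CARD('n)\<close> fin by (simp add: card_Diff_subset finite_subset)
  finally have dim_C: "vec.dim C = CARD('n) - vec.dim U" .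
  have "orth U \<inter> orth C \<subseteq> orth Bs \<inter> orth (Bs' - Bs)"
    using orth_antimono[OF Bs(1)] by (auto simp: C_def orth_span)
  also have "\<dots> = orth (vec.span Bs')"
    using Bs'(1) by (simp add: orth_span flip: orth_Un) (metis Un_Diff_cancel Un_absorb1)
  also have "\<dots> \<subseteq> {0}" using nondegenerate by (auto simp: orth_def span_Bs')
  finally have "vec.dim (orth U \<inter> orth C) = 0" by simp
  then have "vec.dim (orth U) + vec.dim (orth C) \<le> CARD('n)"
    using vec.dim_sums_Int[OF subspace_orth subspace_orth, of U C]
      dim_vec_le_CARD[of "{x + y |x y. x \<in> orth U \<and> y \<in> orth C}"] by linarith
  then show ?thesis
    using dim_orth_ge[of C] dim_orth_ge[of U] dim_C dim_vec_le_CARD[of U] by linarith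
qed

lemma orth_orth:
  assumes symmetric: "\<And>x y. B x y = B y x" and U: "vec.subspace U"
  shows "orth (orth U) = U"
proof (rule sym, rule vec.subspace_dim_equal[OF U subspace_orth])
  show "U \<subseteq> orth (orth U)" using symmetric by (auto simp: orth_def)
  show "vec.dim (orth (orth U)) \<le> vec.dim U" using dim_orth[of U] dim_orth[of "orth U"] by linarith
qed

end

lemma polar_commute: "polar Q x y = polar Q y x"
  unfolding polar_def by (simp add: add.commute)

lemma quadratic_add_polar: "Q (x + y) = Q x + Q y + polar Q x y"
  unfolding polar_def by simp

lemma quadratic_form_scale: "quadratic_form Q \<Longrightarrow> Q (c *s x) = c\<^sup>2 * Q x"
  unfolding quadratic_form_def by blast

lemma quadratic_form_zero: "quadratic_form Q \<Longrightarrow> Q 0 = 0"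
  using quadratic_form_scale[of Q 0 0] by simp

lemma bilinear_form_polar:
  assumes "quadratic_form Q"
  shows "bilinear_form (polar Q)"
proof
  have add: "polar Q (x + y) z = polar Q x z + polar Q y z"
    and scale: "polar Q (c *s x) z = c * polar Q x z" for x y z c
    using assms unfolding quadratic_form_def by auto
  show "polar Q (x + y) z = polar Q x z + polar Q y z" for x y z by (rule add)
  show "polar Q (c *s x) z = c * polar Q x z" for c x z by (rule scale)
  show "polar Q x (y + z) = polar Q x y + polar Q x z" for x y z
    using add[of y z x] by (simp add: polar_commute[of Q x])
  show "polar Q x (c *s z) = c * polar Q x z" for c x z
    using scale[of c z x] by (simp add: polar_commute[of Q x])
qed

lemma two_eq_zero_if_CHAR_2: "CHAR('k::field) = 2 \<Longrightarrow> (2::'k) = 0"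
  using of_nat_CHAR[where 'a='k] by simp

lemma polar_self_char_2:
  assumes "quadratic_form Q" and two: "(2::'k::field) = 0"
  shows "polar Q (x :: 'k^'n) x = 0"
proof -
  have "x + x = 0" using vec.scale_left_distrib[of 1 1 x] two by (simp add: one_add_one)
  then show ?thesis
    using two quadratic_form_zero[OF assms(1)] by (simp add: polar_def flip: mult_2)
qed

lemma ex_square_root:
  assumes two: "(2::'k::field) = 0" and "finite (UNIV :: 'k set) \<or> alg_closed_type TYPE('k)"
  shows "\<exists>c::'k. c * c = a"
  using assms(2)
proof
  assume fin: "finite (UNIV :: 'k set)"
  \<comment> \<open>In characteristic 2 squaring is injective, hence surjective on a finite field.\<close>
  have "inj (\<lambda>x::'k. x * x)"
  proof (rule injI)
    fix x y :: 'k assume xy: "x * x = y * y"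
    have "(x - y) * (x - y) = x * x + y * y - 2 * (x * y)" by (simp add: algebra_simps)
    also have "\<dots> = 0" using two xy by (simp flip: mult_2)
    finally show "x = y" by simp
  qed
  then show ?thesis using fin finite_UNIV_inj_surj by (metis surjD)
next
  assume "alg_closed_type TYPE('k)"
  moreover have "degree [:-a, 0, 1:] > 0" by simp
  ultimately obtain c where "poly [:-a, 0, 1:] c = 0" unfolding alg_closed_type_def by blast
  then show ?thesis by (auto simp: algebra_simps)
qed

lemma dim_qf_radical_le_1:
  fixes Q :: "'k::field^'n \<Rightarrow> 'k"
  assumes qf: "quadratic_form Q" and two: "(2::'k) = 0" and sqrt: "\<And>a::'k. \<exists>c. c * c = a"
    and nd: "qf_nondegenerate Q"
  shows "vec.dim (qf_radical Q) \<le> 1"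
proof (cases "qf_radical Q \<subseteq> {0}")
  case False
  let ?R = "qf_radical Q"
  interpret bilinear_form "polar Q" by (rule bilinear_form_polar[OF qf])
  have R: "vec.subspace ?R" by (simp add: qf_radical_def vec.subspace_def bilinear_simps)
  have Q_inj: "z = 0" if "z \<in> ?R" "Q z = 0" for z
    using nd that vec.subspace_0[OF R] quadratic_form_zero[OF qf]
    unfolding qf_nondegenerate_def by (metis inj_onD)
  obtain x where x: "x \<in> ?R" "x \<noteq> 0" using False by blast
  then have Qx: "Q x \<noteq> 0" using Q_inj by blast
  have "?R \<subseteq> vec.span {x}"
  proof
    fix f assume f: "f \<in> ?R"
    obtain c where c: "c * c = Q f / Q x" using sqrt by blast
    have "f + c *s x \<in> ?R" using R f x(1) vec.subspace_add vec.subspace_scale by blast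
    moreover have "Q (f + c *s x) = Q f + Q f"
      using f c Qx
      by (simp add: quadratic_add_polar quadratic_form_scale[OF qf] qf_radical_def power2_eq_square)
    ultimately have "f + c *s x = 0" using Q_inj two by (simp flip: mult_2)
    then have "f = (- c) *s x" by (simp add: eq_neg_iff_add_eq_0)
    then show "f \<in> vec.span {x}" unfolding vec.span_singleton by (rule range_eqI)
  qed
  then show ?thesis using vec.dim_subset[of ?R "vec.span {x}"] x(2) by simp
qed (simp flip: vec.dim_eq_0)

lemma nondegenerate_polar:
  fixes Q :: "'k::field^'n \<Rightarrow> 'k"
  assumes qf: "quadratic_form Q" and two: "(2::'k) = 0" and sqrt: "\<And>a::'k. \<exists>c. c * c = a"
    and nd: "qf_nondegenerate Q" and even: "even CARD('n)"
  shows "nondegenerate_bilinear_form (polar Q)"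
proof -
  interpret bilinear_form "polar Q" by (rule bilinear_form_polar[OF qf])
  have "radical UNIV = qf_radical Q"
    by (auto simp: radical_def qf_radical_def polar_commute[of Q])
  then have "even (CARD('n) - vec.dim (qf_radical Q))"
    using even_dim_diff_radical[OF vec.subspace_UNIV] polar_self_char_2[OF qf two]
    by (simp add: card_cart_basis)
  moreover have "vec.dim (qf_radical Q) \<le> 1" by (rule dim_qf_radical_le_1[OF qf two sqrt nd])
  moreover have "vec.dim (qf_radical Q) \<le> CARD('n)" by (rule dim_vec_le_CARD)
  ultimately have "even (vec.dim (qf_radical Q))" "vec.dim (qf_radical Q) \<le> 1"
    using even by auto
  then have "vec.dim (qf_radical Q) = 0" by (cases "vec.dim (qf_radical Q)") auto
  then show ?thesis by unfold_locales (auto simp: qf_radical_def)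
qed

lemma orth_lagrangian:
  assumes "nondegenerate_bilinear_form (polar Q)" and "even CARD('n)" and L: "lagrangian Q L"
  shows "bilinear_form.orth (polar Q) L = (L :: ('k::field^'n) set)"
proof -
  interpret nondegenerate_bilinear_form "polar Q" by (rule assms(1))
  have "L \<subseteq> orth L"
    using L by (auto simp: orth_def lagrangian_def polar_def vec.subspace_add)
  moreover have "vec.dim (orth L) \<le> vec.dim L"
    using dim_orth[of L] L assms(2) by (auto simp: lagrangian_def)
  ultimately show ?thesis
    using L vec.subspace_dim_equal[OF _ subspace_orth] by (metis lagrangian_def)
qed

lemma linear_id_add:
  fixes N :: "'k::field^'n \<Rightarrow> 'k^'n"
  assumes "Vector_Spaces.linear (*s) (*s) N"
  shows "Vector_Spaces.linear (*s) (*s) (\<lambda>x. x + N x)"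
proof -
  interpret N: Vector_Spaces.linear "(*s)" "(*s)" N by fact
  show ?thesis by (rule linear_vecI) (simp_all add: N.add N.scale vec.scale_right_distrib)
qed

lemma inj_add_nilpotent:
  fixes N :: "'k::field^'n \<Rightarrow> 'k^'n"
  assumes lin: "Vector_Spaces.linear (*s) (*s) N" and nil: "\<forall>x. (N ^^ m) x = 0"
  shows "inj (\<lambda>x. x + N x)"
proof -
  interpret N: Vector_Spaces.linear "(*s)" "(*s)" N by (rule lin)
  interpret unipotent: Vector_Spaces.linear "(*s)" "(*s)" "\<lambda>x. x + N x"
    by (rule linear_id_add[OF lin])
  have "x = 0" if "x + N x = 0" for x
  proof -
    have "N x = (-1) *s x" using that by (simp add: eq_neg_iff_add_eq_0 add.commute)
    then have "(N ^^ k) x = (-1) ^ k *s x" for k by (induction k) (simp_all add: N.scale)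
    then have "(-1) ^ m *s x = 0" using nil by metis
    then show "x = 0" by simp
  qed
  then show ?thesis
    unfolding unipotent.inj_on_iff_eq_0[OF vec.subspace_UNIV] by blast
qed

locale unipotent_isometry =
  nondegenerate_bilinear_form "polar Q" for Q :: "'k::field^'n \<Rightarrow> 'k" +
  fixes N :: "'k^'n \<Rightarrow> 'k^'n"
  assumes quadratic_form: "quadratic_form Q"
    and linear_N: "Vector_Spaces.linear (*s) (*s) N"
    and nilpotent: "\<exists>m. \<forall>x. (N ^^ m) x = 0"
    and Q_N: "Q (N x) = - polar Q x (N x)"
begin

sublocale N: Vector_Spaces.linear "(*s)" "(*s)" N by (rule linear_N)

lemma Q_add_N: "Q (x + N x) = Q x"
  by (simp add: quadratic_add_polar Q_N)

lemma polar_add_N: "polar Q (x + N x) (y + N y) = polar Q x y"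
proof -
  have "Q (x + N x + (y + N y)) = Q (x + y)"
    using Q_add_N[of "x + y"] by (simp add: N.add algebra_simps)
  then show ?thesis by (simp add: polar_def Q_add_N)
qed

lemma polar_N_right: "polar Q x (N y) = - polar Q (N x) (y + N y)"
  using polar_add_N[of x y] by (simp add: bilinear_simps eq_neg_iff_add_eq_0 algebra_simps)

end

locale unipotent_lagrangian = unipotent_isometry Q N
  for Q :: "'k::field^'n \<Rightarrow> 'k" and N +
  fixes S :: "('k^'n) set"
  assumes even_dim: "even CARD('n)" and lagrangian_S: "lagrangian Q S"
begin

abbreviation "T \<equiv> (\<lambda>x. x + N x) ` S"
abbreviation "U \<equiv> N ` S"
abbreviation "Y \<equiv> {x. N x \<in> T}"
abbreviation "R \<equiv> {y\<in>Y. N y \<in> U}"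

lemma subspace_S: "vec.subspace S"
  using lagrangian_S by (simp add: lagrangian_def)

lemma lagrangian_T: "lagrangian Q T"
proof -
  note lin = linear_id_add[OF linear_N]
  interpret unipotent: Vector_Spaces.linear "(*s)" "(*s)" "\<lambda>x. x + N x" by (rule lin)
  obtain m where "\<forall>x. (N ^^ m) x = 0" using nilpotent by blast
  then have "inj_on (\<lambda>x. x + N x) (vec.span S)"
    using inj_add_nilpotent[OF linear_N] inj_on_subset by blast
  then have "vec.dim T = vec.dim S" by (rule vec.dim_image_eq[OF lin])
  moreover have "\<forall>x\<in>T. Q x = 0" using lagrangian_S by (simp add: lagrangian_def Q_add_N)
  ultimately show ?thesis
    using lagrangian_S unipotent.subspace_image[OF subspace_S] by (simp add: lagrangian_def)
qed

lemma orth_T: "orth T = T"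
  by (rule orth_lagrangian[OF nondegenerate_bilinear_form_axioms even_dim lagrangian_T])

lemma Y_eq_orth_U: "Y = orth U"
proof -
  have "N x \<in> orth T \<longleftrightarrow> x \<in> orth U" for x
    by (auto simp: orth_def polar_N_right[of x])
  then show ?thesis using orth_T by auto
qed

lemma dim_Y_add_dim_U: "vec.dim Y + vec.dim U = CARD('n)"
  unfolding Y_eq_orth_U by (rule dim_orth)

lemma subspace_T: "vec.subspace T"
  using lagrangian_T by (simp add: lagrangian_def)

lemma subspace_U: "vec.subspace U"
  by (rule N.subspace_image[OF subspace_S])

lemma even_dim_Y_diff_dim_R: "even (vec.dim Y - vec.dim R)"
proof -
  interpret a: bilinear_form "\<lambda>x y. polar Q x (N y)"
    by unfold_locales (simp_all add: bilinear_simps N.add N.scale)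
  have Y: "vec.subspace Y" unfolding Y_eq_orth_U by (rule subspace_orth)
  have "\<forall>y\<in>Y. polar Q y (N y) = 0"
  proof
    fix y assume "y \<in> Y"
    moreover have "\<forall>z\<in>T. Q z = 0" using lagrangian_T unfolding lagrangian_def by (elim conjE)
    ultimately have "Q (N y) = 0" by blast
    then show "polar Q y (N y) = 0" using Q_N[of y] by simp
  qed
  moreover have "(\<forall>x\<in>Y. polar Q x (N y) = 0) \<longleftrightarrow> N y \<in> orth Y" for y
    by (simp add: orth_def polar_commute[of Q "N y"])
  then have "a.radical Y = {y\<in>Y. N y \<in> orth Y}" by (simp add: a.radical_def)
  moreover have "orth Y = U"
    using orth_orth[OF polar_commute subspace_U] Y_eq_orth_U by simp
  ultimately show ?thesis using a.even_dim_diff_radical[OF Y] by simp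
qed

lemma dim_R: "vec.dim R = vec.dim (U \<inter> T) + vec.dim {x. N x = 0}"
proof -
  have "R = N -` (T \<inter> U)" by auto
  then have subspace_R: "vec.subspace R"
    using N.subspace_vimage[OF vec.subspace_inter[OF subspace_T subspace_U]] by simp
  have "N ` R = U \<inter> T" by auto
  moreover have "{x\<in>R. N x = 0} = {x. N x = 0}"
    using vec.subspace_0[OF subspace_T] vec.subspace_0[OF subspace_U] by auto
  ultimately show ?thesis using rank_nullity_subspace[OF linear_N subspace_R] by simp
qed

lemma dim_S_diff: "vec.dim S - vec.dim (S \<inter> T) = vec.dim U - vec.dim (U \<inter> T)"
proof -
  have T_iff: "s \<in> T \<longleftrightarrow> N s \<in> T" if "s \<in> S" for s
  proof
    have sum: "s + N s \<in> T" using that by blast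
    show "N s \<in> T" if "s \<in> T" using vec.subspace_diff[OF subspace_T sum that] by simp
    show "s \<in> T" if "N s \<in> T" using vec.subspace_diff[OF subspace_T sum that] by simp
  qed
  have "N ` (S \<inter> T) = U \<inter> T" using T_iff by auto
  moreover have "{x\<in>S \<inter> T. N x = 0} = {x\<in>S. N x = 0}"
    using T_iff vec.subspace_0[OF subspace_T] by auto
  ultimately have "vec.dim (S \<inter> T) = vec.dim (U \<inter> T) + vec.dim {x\<in>S. N x = 0}"
    using rank_nullity_subspace[OF linear_N vec.subspace_inter[OF subspace_S subspace_T]] by simp
  then show ?thesis using rank_nullity_subspace[OF linear_N subspace_S] by simp
qed

theorem dim_S_diff_parity:
  "(vec.dim S - vec.dim (S \<inter> T)) mod 2 = vec.dim {x. N x = 0} mod 2"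
proof -
  let ?w = "vec.dim (U \<inter> T)" and ?k = "vec.dim {x. N x = 0}"
  have "vec.dim R \<le> vec.dim Y" by (rule vec.dim_subset) blast
  then obtain a where a: "vec.dim Y = ?w + ?k + a"
    unfolding dim_R using le_Suc_ex by blast
  have "?w \<le> vec.dim U" by (rule vec.dim_subset) blast
  then obtain b where b: "vec.dim U = ?w + b" using le_Suc_ex by blast
  have "even a" using even_dim_Y_diff_dim_R unfolding dim_R a by simp
  moreover have "a + 2 * ?w + ?k + b = CARD('n)" using dim_Y_add_dim_U a b by simp
  then have "even (a + 2 * ?w + ?k + b)" using even_dim by simp
  ultimately have "even (?k + b)" by simp
  then have "b mod 2 = ?k mod 2" by (metis even_add even_iff_mod_2_eq_zero odd_iff_mod_2_eq_one)
  then show ?thesis unfolding dim_S_diff b by simp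
qed

end

theorem mainTheorem10:
  fixes Q :: "'k::field ^ 'n \<Rightarrow> 'k" and N :: "'k ^ 'n \<Rightarrow> 'k ^ 'n"
  assumes "CHAR('k) = 2"
    and "finite (UNIV :: 'k set) \<or> alg_closed_type TYPE('k)"
    and "even CARD('n)"
    and "quadratic_form Q"
    and "qf_nondegenerate Q"
    and "\<exists>S. lagrangian Q S"
    and "N \<in> M_tilde Q"
  shows "\<forall>S. lagrangian Q S \<longrightarrow>
           (vec.dim S - vec.dim (S \<inter> (\<lambda>x. x + N x) ` S)) mod 2 = vec.dim {x. N x = 0} mod 2"
proof (intro allI impI)
  fix S assume S: "lagrangian Q S"
  have two: "(2::'k) = 0" by (rule two_eq_zero_if_CHAR_2[OF assms(1)])
  have "\<And>a::'k. \<exists>c. c * c = a" by (rule ex_square_root[OF two assms(2)])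
  then have "nondegenerate_bilinear_form (polar Q)"
    by (rule nondegenerate_polar[OF assms(4) two _ assms(5,3)])
  then interpret unipotent_lagrangian Q N S
    using assms(3,4,7) S
    by (simp add: unipotent_lagrangian_def unipotent_lagrangian_axioms_def unipotent_isometry_def
        unipotent_isometry_axioms_def M_tilde_def)
  show "(vec.dim S - vec.dim (S \<inter> (\<lambda>x. x + N x) ` S)) mod 2 = vec.dim {x. N x = 0} mod 2"
    by (rule dim_S_diff_parity)
qed

end
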